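(* Let $\boldsymbol u^{\mathrm{low}},\boldsymbol u^{\mathrm{upp}}\in\mathbb R^{N_1\times N_2\times K}$ with $\boldsymbol u^{\mathrm{low}}\le\boldsymbol u^{\mathrm{upp}}$ entrywise, $N:=N_1N_2K$, and let $\boldsymbol A$, $\sigma$, $\mathrm{flat}$, $\tilde{\boldsymbol A}_1,\dots,\tilde{\boldsymbol A}_N\in\mathbb R^{3\times N}$, $\boldsymbol z^{\mathrm{low}}=\mathrm{flat}(\boldsymbol u^{\mathrm{low}})$ and $\boldsymbol z^{\mathrm{upp}}=\mathrm{flat}(\boldsymbol u^{\mathrm{upp}})$ be as defined in the context. Then the optimization problem $$\min_{\boldsymbol z\in\mathbb R^N}\ \sum_{\ell=1}^N\|\tilde{\boldsymbol A}_\ell\boldsymbol z\|\quad\text{s.t.}\quad\boldsymbol z^{\mathrm{low}}\le\boldsymbol z\le\boldsymbol z^{\mathrm{upp}}$$ is equivalent to the second-order cone program $$\min_{\boldsymbol v\in\mathbb R^n}\ \langle\boldsymbol\xi,\boldsymbol v\rangle\quad\text{s.t.}\quad\|\boldsymbol B_i\boldsymbol v+\boldsymbol c_i\|\le\langle\boldsymbol d_i,\boldsymbol v\rangle+\eta_i,\ i\in[m],\qquad\boldsymbol H\boldsymbol v=\boldsymbol h,$$ under the identifications $n=2N$, $m=3N$, $\boldsymbol\xi=\begin{bmatrix}\boldsymbol 0_N\\ \boldsymbol 1_N\end{bmatrix}$, $\boldsymbol H=\boldsymbol 0_{1\times n}$, $\boldsymbol h=0$, and, for $\ell\in[N]$,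 $$\boldsymbol B_\ell=\boldsymbol 0_{1\times n},\quad\boldsymbol B_{N+\ell}=\boldsymbol 0_{1\times n},\quad\boldsymbol B_{2N+\ell}=\begin{bmatrix}\tilde{\boldsymbol A}_\ell&\boldsymbol 0_{3\times N}\end{bmatrix},$$ $$\boldsymbol c_\ell=0,\quad\boldsymbol c_{N+\ell}=0,\quad\boldsymbol c_{2N+\ell}=\boldsymbol 0_3,$$ $$\boldsymbol d_\ell=\boldsymbol e^n_\ell,\quad\boldsymbol d_{N+\ell}=-\boldsymbol e^n_\ell,\quad\boldsymbol d_{2N+\ell}=\boldsymbol e^n_{N+\ell},$$ $$\eta_\ell=-z^{\mathrm{low}}_\ell,\quad\eta_{N+\ell}=z^{\mathrm{upp}}_\ell,\quad\eta_{2N+\ell}=0.$$ In particular, if $\bar{\boldsymbol v}\in\mathbb R^{2N}$ is a minimizer of this second-order cone program, then $\bar{\boldsymbol u}$ given by $\bar u_{i,j,k}=\bar v_{\sigma(i,j,k)}$ is a minimizer of the TV-ULoG optimization problem $$\min_{\boldsymbol u\in\mathbb R^{N_1\times N_2\times K}}\ \sum_{i,j,k}\|(\boldsymbol A\boldsymbol u)_{i,j,k}\|\quad\text{s.t.}\quad\boldsymbol u^{\mathrm{low}}\le\boldsymbol u\le\boldsymbol u^{\mathrm{upp}}.$$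
   Context: Notation: $[n]=\{1,\dots,n\}$; $\|\cdot\|$ is the Euclidean norm, $\langle\cdot,\cdot\rangle$ the Euclidean inner product; inequalities between arrays or vectors are entrywise. $\boldsymbol 0_n,\boldsymbol 1_n\in\mathbb R^n$ are the all-zeros and all-ones vectors, $\boldsymbol 0_{m\times n}$ is the zero matrix, $\boldsymbol e_i^n$ is the $i$-th standard basis vector of $\mathbb R^n$. "Equivalent" means: the two problems have the same optimal value, and $\boldsymbol z\in\mathbb R^N$ is a minimizer of the first if and only if there is $\boldsymbol q\in\mathbb R^N$ such that $\boldsymbol v=[\boldsymbol z;\boldsymbol q]\in\mathbb R^{2N}$ is a minimizer of the second. Flattening: $\sigma:[N_1]\times[N_2]\times[K]\to[N]$, $\sigma(i,j,k)=(i-1)N_2K+(j-1)K+k$, is an enumeration (bijection), and $\mathrm{flat}:\mathbb R^{N_1\times N_2\times K}\to\mathbb R^N$ is given by $\mathrm{flat}(\boldsymbol u)_{\sigma(i,j,k)}=u_{i,j,k}$. The matrices $\tilde{\boldsymbol A}_1,\dots,\tilde{\boldsymbol A}_N\in\mathbb R^{3\times N}$ are determined by $(\tilde{\boldsymbol A}_{\sigma(i,j,k)}\,\mathrm{flat}(\boldsymbol u))_r=(\boldsymbol A\boldsymbol u)_{i,j,k,r}$ for all $\boldsymbol u\in\mathbb R^{N_1\times N_2\times K}$, $r\in[3]$, $(i,j,k)\in[N_1]\times[N_2]\times[K]$. Definition of $\boldsymbol A=\tilde{\boldsymbol\nabla}_{\boldsymbol x,t}\tilde{\boldsymbol\Delta}:\mathbb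 R^{N_1\times N_2\times K}\to\mathbb R^{N_1\times N_2\times K\times 3}$: $N_1,N_2\ge 2$, $K\ge1$ are integers, $h_1,h_2>0$ grid sizes, $0<t_1<\dots<t_K$ with $t_{k+1}=bt_k$ for a fixed $b>1$. The discrete scale-normalized Laplacian $\tilde{\boldsymbol\Delta}:\mathbb R^{N_1\times N_2\times K}\to\mathbb R^{N_1\times N_2\times K}$ is $$(\tilde{\boldsymbol\Delta}\boldsymbol u)_{i,j,k}=t_k\Big(\tfrac{u_{i+1,j,k}-2u_{i,j,k}+u_{i-1,j,k}}{h_1^2}+\tfrac{u_{i,j+1,k}-2u_{i,j,k}+u_{i,j-1,k}}{h_2^2}\Big),$$ with the conventions $u_{0,j,k}:=u_{2,j,k}$, $u_{N_1+1,j,k}:=u_{N_1-1,j,k}$, $u_{i,0,k}:=u_{i,2,k}$, $u_{i,N_2+1,k}:=u_{i,N_2-1,k}$. The discrete scale-space gradient $\tilde{\boldsymbol\nabla}_{\boldsymbol x,t}:\mathbb R^{N_1\times N_2\times K}\to\mathbb R^{N_1\times N_2\times K\times 3}$ has as $(i,j,k)$ component the vector in $\mathbb R^3$ with entries $$t_k^{1/2}\tfrac{u_{i+1,j,k}-u_{i,j,k}}{h_1},\qquad t_k^{1/2}\tfrac{u_{i,j+1,k}-u_{i,j,k}}{h_2},\qquad \tfrac{1}{b-1}(u_{i,j,k+1}-u_{i,j,k}),$$ with the conventions (for this operator) $u_{N_1+1,j,k}:=u_{N_1,j,k}$, $u_{i,N_2+1,k}:=u_{i,N_2,k}$, $u_{i,j,K+1}:=u_{i,j,K}$.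 The component $(\boldsymbol A\boldsymbol u)_{i,j,k}$ is a vector in $\mathbb R^3$. *)

theory Defs
  imports
    "HOL-Library.FuncSet"
    "HOL-Library.Extended_Real"
    "HOL-Analysis.L2_Norm"
    "Jordan_Normal_Form.Matrix"
begin

text \<open>A minimization problem is given by its feasible set and its objective. The optimal value is an
  infimum in the extended reals, so that it also makes sense for infeasible or unbounded problems.\<close>

type_synonym 'a problem = "'a set \<times> ('a \<Rightarrow> real)"

definition optimal_value :: "'a problem \<Rightarrow> ereal" where
  "optimal_value P = (INF x\<in>fst P. ereal (snd P x))"

definition is_minimizer :: "'a problem \<Rightarrow> 'a \<Rightarrow> bool" where
  "is_minimizer P x \<longleftrightarrow> is_arg_min (snd P) (\<lambda>y. y \<in> fst P) x"

definition equivalent_problems :: "nat \<Rightarrow> real vec problem \<Rightarrow> real vec problem \<Rightarrow> bool" where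
  "equivalent_problems N P Q \<longleftrightarrow>
     optimal_value P = optimal_value Q \<and>
     (\<forall>z\<in>carrier_vec N. is_minimizer P z \<longleftrightarrow> (\<exists>q\<in>carrier_vec N. is_minimizer Q (z @\<^sub>v q)))"

definition vec_norm2 :: "real vec \<Rightarrow> real" where
  "vec_norm2 v = L2_set (\<lambda>i. v $ i) {..<dim_vec v}"

definition append_cols :: "real mat \<Rightarrow> real mat \<Rightarrow> real mat" where
  "append_cols A B = four_block_mat A B (0\<^sub>m 0 (dim_col A)) (0\<^sub>m 0 (dim_col B))"

definition socp :: "nat \<Rightarrow> nat \<Rightarrow> real vec \<Rightarrow> (nat \<Rightarrow> real mat) \<Rightarrow> (nat \<Rightarrow> real vec) \<Rightarrow>
    (nat \<Rightarrow> real vec) \<Rightarrow> (nat \<Rightarrow> real) \<Rightarrow> real mat \<Rightarrow> real vec \<Rightarrow> real vec problem" where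
  "socp n m \<xi> B c d \<eta> H h =
     ({v \<in> carrier_vec n.
         (\<forall>i\<in>{1..m}. vec_norm2 (B i *\<^sub>v v + c i) \<le> d i \<bullet> v + \<eta> i) \<and> H *\<^sub>v v = h},
      \<lambda>v. \<xi> \<bullet> v)"

text \<open>An array of size \<open>N1 \<times> N2 \<times> K\<close> is a function on the 1-based index grid which is
  \<open>undefined\<close> outside the grid, so that arrays are equal iff they agree on the grid.\<close>

type_synonym array = "nat \<times> nat \<times> nat \<Rightarrow> real"

definition grid :: "nat \<Rightarrow> nat \<Rightarrow> nat \<Rightarrow> (nat \<times> nat \<times> nat) set" where
  "grid N1 N2 K = {1..N1} \<times> {1..N2} \<times> {1..K}"

definition arrays :: "nat \<Rightarrow> nat \<Rightarrow> nat \<Rightarrow> array set" where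
  "arrays N1 N2 K = grid N1 N2 K \<rightarrow>\<^sub>E UNIV"

text \<open>The enumeration takes values in \<open>{1..N1 * N2 * K}\<close>, whereas vectors are indexed from 0:
  the component of number \<open>l\<close> of a vector \<open>v\<close> is \<open>v $ (l - 1)\<close>.\<close>

fun sigma :: "nat \<Rightarrow> nat \<Rightarrow> nat \<times> nat \<times> nat \<Rightarrow> nat" where
  "sigma N2 K (i, j, k) = (i - 1) * N2 * K + (j - 1) * K + k"

definition flat :: "nat \<Rightarrow> nat \<Rightarrow> nat \<Rightarrow> array \<Rightarrow> real vec" where
  "flat N1 N2 K u =
     vec (N1 * N2 * K) (\<lambda>l. u (inv_into (grid N1 N2 K) (sigma N2 K) (l + 1)))"

definition unflat :: "nat \<Rightarrow> nat \<Rightarrow> nat \<Rightarrow> real vec \<Rightarrow> array" where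
  "unflat N1 N2 K v = (\<lambda>p\<in>grid N1 N2 K. v $ (sigma N2 K p - 1))"

text \<open>Boundary conventions along one axis with indices \<open>1..n\<close>: \<open>mirror\<close> replaces 0 by 2
  and \<open>n + 1\<close> by \<open>n - 1\<close>, \<open>clamp\<close> replaces \<open>n + 1\<close> by \<open>n\<close>.\<close>

definition mirror :: "nat \<Rightarrow> nat \<Rightarrow> nat" where
  "mirror n i = (if i = 0 then 2 else if i = n + 1 then n - 1 else i)"

definition clamp :: "nat \<Rightarrow> nat \<Rightarrow> nat" where
  "clamp n i = (if i = n + 1 then n else i)"

definition laplacian ::
    "nat \<Rightarrow> nat \<Rightarrow> nat \<Rightarrow> real \<Rightarrow> real \<Rightarrow> (nat \<Rightarrow> real) \<Rightarrow> array \<Rightarrow> array" where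
  "laplacian N1 N2 K h1 h2 t u = (\<lambda>(i, j, k)\<in>grid N1 N2 K.
     t k * ((u (mirror N1 (i + 1), j, k) - 2 * u (i, j, k) + u (mirror N1 (i - 1), j, k)) / h1\<^sup>2
          + (u (i, mirror N2 (j + 1), k) - 2 * u (i, j, k) + u (i, mirror N2 (j - 1), k)) / h2\<^sup>2))"

definition gradient ::
    "nat \<Rightarrow> nat \<Rightarrow> nat \<Rightarrow> real \<Rightarrow> real \<Rightarrow> (nat \<Rightarrow> real) \<Rightarrow> real \<Rightarrow>
     array \<Rightarrow> nat \<times> nat \<times> nat \<Rightarrow> real vec" where
  "gradient N1 N2 K h1 h2 t b u = (\<lambda>(i, j, k)\<in>grid N1 N2 K. vec_of_list
     [sqrt (t k) * ((u (clamp N1 (i + 1), j, k) - u (i, j, k)) / h1),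
      sqrt (t k) * ((u (i, clamp N2 (j + 1), k) - u (i, j, k)) / h2),
      1 / (b - 1) * (u (i, j, clamp K (k + 1)) - u (i, j, k))])"

definition ulog_op ::
    "nat \<Rightarrow> nat \<Rightarrow> nat \<Rightarrow> real \<Rightarrow> real \<Rightarrow> (nat \<Rightarrow> real) \<Rightarrow> real \<Rightarrow>
     array \<Rightarrow> nat \<times> nat \<times> nat \<Rightarrow> real vec" where
  "ulog_op N1 N2 K h1 h2 t b u =
     gradient N1 N2 K h1 h2 t b (laplacian N1 N2 K h1 h2 t u)"

text \<open>The matrix with number \<open>l\<close> is determined by its action on flattened arrays; existence and
  uniqueness are proved below.\<close>

definition is_flat_mat ::
    "nat \<Rightarrow> nat \<Rightarrow> nat \<Rightarrow> real \<Rightarrow> real \<Rightarrow> (nat \<Rightarrow> real) \<Rightarrow> real \<Rightarrow> nat \<Rightarrow> real mat \<Rightarrow> bool" where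
  "is_flat_mat N1 N2 K h1 h2 t b l M \<longleftrightarrow>
     M \<in> carrier_mat 3 (N1 * N2 * K) \<and>
     (\<forall>u\<in>arrays N1 N2 K. \<forall>r<3. \<forall>p\<in>grid N1 N2 K. sigma N2 K p = l \<longrightarrow>
        (M *\<^sub>v flat N1 N2 K u) $ r = ulog_op N1 N2 K h1 h2 t b u p $ r)"

definition flat_mat ::
    "nat \<Rightarrow> nat \<Rightarrow> nat \<Rightarrow> real \<Rightarrow> real \<Rightarrow> (nat \<Rightarrow> real) \<Rightarrow> real \<Rightarrow> nat \<Rightarrow> real mat" where
  "flat_mat N1 N2 K h1 h2 t b l = (THE M. is_flat_mat N1 N2 K h1 h2 t b l M)"

definition tv_ulog ::
    "nat \<Rightarrow> nat \<Rightarrow> nat \<Rightarrow> real \<Rightarrow> real \<Rightarrow> (nat \<Rightarrow> real) \<Rightarrow> real \<Rightarrow> array \<Rightarrow> array \<Rightarrow> array problem"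
  where
  "tv_ulog N1 N2 K h1 h2 t b ulow uupp =
     ({u \<in> arrays N1 N2 K. \<forall>p\<in>grid N1 N2 K. ulow p \<le> u p \<and> u p \<le> uupp p},
      \<lambda>u. \<Sum>p\<in>grid N1 N2 K. vec_norm2 (ulog_op N1 N2 K h1 h2 t b u p))"

definition box_problem :: "nat \<Rightarrow> (nat \<Rightarrow> real mat) \<Rightarrow> real vec \<Rightarrow> real vec \<Rightarrow> real vec problem" where
  "box_problem N A zlow zupp =
     ({z \<in> carrier_vec N. zlow \<le> z \<and> z \<le> zupp}, \<lambda>z. \<Sum>l\<in>{1..N}. vec_norm2 (A l *\<^sub>v z))"

lemma sigma_in:
  assumes "p \<in> grid N1 N2 K"
  shows "sigma N2 K p \<in> {1..N1 * N2 * K}"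
proof -
  obtain i j k where p: "p = (i, j, k)" and i: "1 \<le> i" "i \<le> N1" and j: "1 \<le> j" "j \<le> N2"
    and k: "1 \<le> k" "k \<le> K"
    using assms by (cases p) (auto simp: grid_def)
  have a: "(j - 1) * K + k \<le> N2 * K"
  proof -
    have "(j - 1) * K + k \<le> (j - 1) * K + K" using k by simp
    also have "\<dots> = j * K" using j by (cases j) auto
    also have "\<dots> \<le> N2 * K" using j by simp
    finally show ?thesis .
  qed
  have "(i - 1) * N2 * K + ((j - 1) * K + k) \<le> (i - 1) * (N2 * K) + N2 * K"
    using a by simp
  also have "\<dots> = i * (N2 * K)" using i by (cases i) auto
  also have "\<dots> \<le> N1 * (N2 * K)" using i by simp
  finally show ?thesis using p k by (simp add: mult.assoc)
qed

lemma mixed_radix: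
  fixes x x' y y' n :: nat
  assumes "x * n + y = x' * n + y'" "y < n" "y' < n"
  shows "x = x'" "y = y'"
proof -
  have "(x * n + y) div n = x" "(x * n + y) mod n = y" using assms(2) by simp_all
  moreover have "(x' * n + y') div n = x'" "(x' * n + y') mod n = y'" using assms(3) by simp_all
  ultimately show "x = x'" "y = y'" using assms(1) by simp_all
qed

lemma inj_on_sigma: "inj_on (sigma N2 K) (grid N1 N2 K)"
proof (rule inj_onI)
  fix p q assume pq: "p \<in> grid N1 N2 K" "q \<in> grid N1 N2 K" and eq: "sigma N2 K p = sigma N2 K q"
  obtain i j k where p: "p = (i, j, k)" and P: "1 \<le> i" "1 \<le> j" "j \<le> N2" "1 \<le> k" "k \<le> K"
    using pq by (cases p) (auto simp: grid_def)
  obtain i' j' k' where q: "q = (i', j', k')"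
    and Q: "1 \<le> i'" "1 \<le> j'" "j' \<le> N2" "1 \<le> k'" "k' \<le> K"
    using pq by (cases q) (auto simp: grid_def)
  have "((i - 1) * N2 + (j - 1)) * K + (k - 1) = ((i' - 1) * N2 + (j' - 1)) * K + (k' - 1)"
    (is "?a * K + ?c = ?a' * K + ?c'")
    using eq P Q by (simp add: p q algebra_simps)
  moreover have "?c < K" "?c' < K" using P Q by auto
  ultimately have ac: "?a = ?a'" "?c = ?c'" using mixed_radix by blast+
  have "j - 1 < N2" "j' - 1 < N2" using P Q by auto
  then have "i - 1 = i' - 1" "j - 1 = j' - 1" using mixed_radix ac(1) by blast+
  then show "p = q" using P Q ac(2) by (auto simp: p q)
qed

lemma bij_betw_sigma: "bij_betw (sigma N2 K) (grid N1 N2 K) {1..N1 * N2 * K}"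
proof -
  have "sigma N2 K ` grid N1 N2 K \<subseteq> {1..N1 * N2 * K}" using sigma_in by blast
  moreover have "card (sigma N2 K ` grid N1 N2 K) = card {1..N1 * N2 * K}"
    by (subst card_image[OF inj_on_sigma]) (simp add: grid_def card_cartesian_product)
  ultimately have "sigma N2 K ` grid N1 N2 K = {1..N1 * N2 * K}"
    by (intro card_subset_eq) auto
  with inj_on_sigma show ?thesis by (simp add: bij_betw_def)
qed

lemma sigma_surj:
  assumes "l \<in> {1..N1 * N2 * K}"
  obtains p where "p \<in> grid N1 N2 K" "sigma N2 K p = l"
  using assms bij_betw_imp_surj_on[OF bij_betw_sigma[of N2 K N1]] by (metis imageE)

lemma flat_carrier [simp]: "flat N1 N2 K u \<in> carrier_vec (N1 * N2 * K)"
  by (simp add: flat_def)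

lemma flat_sigma:
  assumes "p \<in> grid N1 N2 K"
  shows "flat N1 N2 K u $ (sigma N2 K p - 1) = u p"
proof -
  have "sigma N2 K p \<in> {1..N1 * N2 * K}" by (rule sigma_in[OF assms])
  then have "sigma N2 K p - 1 < N1 * N2 * K" "sigma N2 K p - 1 + 1 = sigma N2 K p" by auto
  then show ?thesis
    using assms inj_on_sigma[of N2 K N1] by (simp add: flat_def inv_into_f_f del: Suc_pred One_nat_def)
qed

lemma unflat_in_arrays: "unflat N1 N2 K v \<in> arrays N1 N2 K"
  by (auto simp: unflat_def arrays_def)

lemma flat_unflat:
  assumes "v \<in> carrier_vec (N1 * N2 * K)"
  shows "flat N1 N2 K (unflat N1 N2 K v) = v"
proof (rule eq_vecI)
  fix c assume "c < dim_vec v"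
  then have "c + 1 \<in> {1..N1 * N2 * K}" using assms by auto
  then obtain p where p: "p \<in> grid N1 N2 K" "sigma N2 K p = c + 1"
    by (rule sigma_surj)
  show "flat N1 N2 K (unflat N1 N2 K v) $ c = v $ c"
    using flat_sigma[OF p(1), of "unflat N1 N2 K v"] p by (simp add: unflat_def)
qed (use assms in \<open>simp add: flat_def\<close>)

lemma unflat_flat:
  assumes "u \<in> arrays N1 N2 K"
  shows "unflat N1 N2 K (flat N1 N2 K u) = u"
  using assms by (intro ext) (auto simp: unflat_def flat_sigma arrays_def PiE_def extensional_def
      simp del: sigma.simps One_nat_def)

text \<open>Linear functionals, written as expansion in the unit arrays.\<close>

definition expands :: "nat \<Rightarrow> nat \<Rightarrow> nat \<Rightarrow> (array \<Rightarrow> real) \<Rightarrow> bool" where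
  "expands N1 N2 K L \<longleftrightarrow> (\<forall>u. L u =
     (\<Sum>c<N1 * N2 * K. L (unflat N1 N2 K (unit_vec (N1 * N2 * K) c)) * flat N1 N2 K u $ c))"

lemma expandsD:
  "expands N1 N2 K L \<Longrightarrow> L u =
     (\<Sum>c<N1 * N2 * K. L (unflat N1 N2 K (unit_vec (N1 * N2 * K) c)) * flat N1 N2 K u $ c)"
  unfolding expands_def by (erule spec)

lemma expands_eval:
  assumes "p \<in> grid N1 N2 K"
  shows "expands N1 N2 K (\<lambda>u. u p)"
proof -
  let ?N = "N1 * N2 * K" and ?s = "sigma N2 K p - 1"
  have s: "?s < ?N" using sigma_in[OF assms] by auto
  have "u p = (\<Sum>c<?N. unflat N1 N2 K (unit_vec ?N c) p * flat N1 N2 K u $ c)" for u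
  proof -
    have "(\<Sum>c<?N. unflat N1 N2 K (unit_vec ?N c) p * flat N1 N2 K u $ c)
        = (\<Sum>c<?N. if c = ?s then flat N1 N2 K u $ c else 0)"
      using assms s by (intro sum.cong) (auto simp: unflat_def simp del: One_nat_def)
    also have "\<dots> = flat N1 N2 K u $ ?s" using s by simp
    finally show ?thesis using flat_sigma[OF assms] by simp
  qed
  then show ?thesis by (simp add: expands_def)
qed

lemma expands_add:
  assumes "expands N1 N2 K L" "expands N1 N2 K L'"
  shows "expands N1 N2 K (\<lambda>u. L u + L' u)"
  unfolding expands_def
proof
  fix u
  show "L u + L' u = (\<Sum>c<N1 * N2 * K. (L (unflat N1 N2 K (unit_vec (N1 * N2 * K) c)) +
      L' (unflat N1 N2 K (unit_vec (N1 * N2 * K) c))) * flat N1 N2 K u $ c)"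
    using expandsD[OF assms(1), of u] expandsD[OF assms(2), of u]
    by (simp only: distrib_right sum.distrib)
qed

lemma expands_diff:
  assumes "expands N1 N2 K L" "expands N1 N2 K L'"
  shows "expands N1 N2 K (\<lambda>u. L u - L' u)"
  unfolding expands_def
proof
  fix u
  show "L u - L' u = (\<Sum>c<N1 * N2 * K. (L (unflat N1 N2 K (unit_vec (N1 * N2 * K) c)) -
      L' (unflat N1 N2 K (unit_vec (N1 * N2 * K) c))) * flat N1 N2 K u $ c)"
    using expandsD[OF assms(1), of u] expandsD[OF assms(2), of u]
    by (simp only: left_diff_distrib sum_subtractf)
qed

lemma expands_scale:
  assumes "expands N1 N2 K L"
  shows "expands N1 N2 K (\<lambda>u. a * L u)"
  unfolding expands_def
proof
  fix u
  show "a * L u = (\<Sum>c<N1 * N2 * K.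
      a * L (unflat N1 N2 K (unit_vec (N1 * N2 * K) c)) * flat N1 N2 K u $ c)"
    using expandsD[OF assms, of u] by (simp only: sum_distrib_left mult.assoc)
qed

lemma expands_divide: "expands N1 N2 K L \<Longrightarrow> expands N1 N2 K (\<lambda>u. L u / a)"
  using expands_scale[of N1 N2 K L "1 / a"] by simp

lemma expands_laplacian:
  assumes "p \<in> grid N1 N2 K" "N1 \<ge> 2" "N2 \<ge> 2"
  shows "expands N1 N2 K (\<lambda>u. laplacian N1 N2 K h1 h2 t u p)"
proof -
  obtain i j k where p: "p = (i, j, k)" by (cases p)
  show ?thesis
    using assms unfolding p
    by (simp add: laplacian_def)
       (intro expands_scale expands_add expands_divide expands_diff expands_eval;
         auto simp: grid_def mirror_def)
qed

lemma expands_ulog_op: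
  assumes "p \<in> grid N1 N2 K" "N1 \<ge> 2" "N2 \<ge> 2" "r < 3"
  shows "expands N1 N2 K (\<lambda>u. ulog_op N1 N2 K h1 h2 t b u p $ r)"
proof -
  obtain i j k where p: "p = (i, j, k)" by (cases p)
  have grid: "(i, j, k) \<in> grid N1 N2 K" "(clamp N1 (i + 1), j, k) \<in> grid N1 N2 K"
    "(i, clamp N2 (j + 1), k) \<in> grid N1 N2 K" "(i, j, clamp K (k + 1)) \<in> grid N1 N2 K"
    using assms unfolding p by (auto simp: grid_def clamp_def)
  note expands = expands_scale expands_divide expands_diff expands_laplacian[OF _ assms(2,3)]
  consider "r = 0" | "r = Suc 0" | "r = Suc (Suc 0)" using assms(4) by linarith
  then show ?thesis
  proof cases
    case 1
    with grid(1) show ?thesis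
      unfolding p ulog_op_def gradient_def by simp (intro expands grid[simplified])
  next
    case 2
    with grid(1) show ?thesis
      unfolding p ulog_op_def gradient_def by simp (intro expands grid[simplified])
  next
    case 3
    with grid(1) show ?thesis
      unfolding p ulog_op_def gradient_def by simp (intro expands grid[simplified])
  qed
qed

lemma ex1_is_flat_mat:
  assumes "N1 \<ge> 2" "N2 \<ge> 2" "l \<in> {1..N1 * N2 * K}"
  shows "\<exists>!M. is_flat_mat N1 N2 K h1 h2 t b l M"
proof -
  let ?N = "N1 * N2 * K"
  obtain p where p: "p \<in> grid N1 N2 K" "sigma N2 K p = l"
    using assms(3) by (rule sigma_surj)
  have p_unique: "q = p" if "q \<in> grid N1 N2 K" "sigma N2 K q = l" for q
    using inj_onD[OF inj_on_sigma[of N2 K N1]] p that by blast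
  define M where "M = mat 3 ?N
    (\<lambda>(r, c). ulog_op N1 N2 K h1 h2 t b (unflat N1 N2 K (unit_vec ?N c)) p $ r)"
  show ?thesis
  proof (rule ex1I[of _ M])
    have "(M *\<^sub>v flat N1 N2 K u) $ r = ulog_op N1 N2 K h1 h2 t b u p $ r" if "r < 3" for u r
    proof -
      have "(M *\<^sub>v flat N1 N2 K u) $ r = (\<Sum>c<?N.
          ulog_op N1 N2 K h1 h2 t b (unflat N1 N2 K (unit_vec ?N c)) p $ r * flat N1 N2 K u $ c)"
        using that by (simp add: M_def scalar_prod_def flat_def atLeast0LessThan)
      also have "\<dots> = ulog_op N1 N2 K h1 h2 t b u p $ r"
        by (rule expandsD[OF expands_ulog_op[OF p(1) assms(1,2) that], symmetric])
      finally show ?thesis .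
    qed
    then show "is_flat_mat N1 N2 K h1 h2 t b l M"
      unfolding is_flat_mat_def using p_unique by (auto simp: M_def)
  next
    fix M' assume M': "is_flat_mat N1 N2 K h1 h2 t b l M'"
    then have car: "M' \<in> carrier_mat 3 ?N" by (simp add: is_flat_mat_def)
    show "M' = M"
    proof (rule eq_matI)
      fix r c assume "r < dim_row M" "c < dim_col M"
      then have rc: "r < 3" "c < ?N" by (auto simp: M_def)
      let ?u = "unflat N1 N2 K (unit_vec ?N c)"
      have "(M' *\<^sub>v flat N1 N2 K ?u) $ r = ulog_op N1 N2 K h1 h2 t b ?u p $ r"
        using M' rc p unflat_in_arrays unfolding is_flat_mat_def by blast
      then show "M' $$ (r, c) = M $$ (r, c)"
        using rc car by (simp add: M_def flat_unflat)
    qed (use car in \<open>auto simp: M_def\<close>)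
  qed
qed

lemma is_flat_mat_flat_mat:
  assumes "N1 \<ge> 2" "N2 \<ge> 2" "l \<in> {1..N1 * N2 * K}"
  shows "is_flat_mat N1 N2 K h1 h2 t b l (flat_mat N1 N2 K h1 h2 t b l)"
  unfolding flat_mat_def by (rule theI'[OF ex1_is_flat_mat[OF assms]])

end

theory Submission
  imports Defs
begin

text \<open>Each cone constraint of the third kind says that a slack variable dominates one norm of the
  objective; the cheapest slack for a given \<open>z\<close> is the norm itself. So the cone program projects
  onto the box problem without raising the objective, and this projection has a section preserving
  it. Flattening relates the box problem to the array problem in the same way.\<close>

text \<open>If \<open>v\<close> minimizes \<open>g\<close> over \<open>T\<close> and
  \<open>z\<close> is in \<open>S\<close>, then \<open>f (p v) <= g v <= g (s z) <= f z\<close>;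
  exchanging the roles of \<open>p\<close> and \<open>s\<close> gives the other direction. For the
  optimal values, each feasible point on either side is matched by one on the other side that costs
  no more.\<close>

lemma
  fixes f :: "'a \<Rightarrow> real" and g :: "'b \<Rightarrow> real"
  assumes proj: "\<And>v. v \<in> T \<Longrightarrow> p v \<in> S \<and> f (p v) \<le> g v"
    and lift: "\<And>z. z \<in> S \<Longrightarrow> s z \<in> T \<and> g (s z) \<le> f z"
  shows optimal_value_eq_of_section: "optimal_value (S, f) = optimal_value (T, g)"
    and is_minimizer_proj: "is_minimizer (T, g) v \<Longrightarrow> is_minimizer (S, f) (p v)"
    and is_minimizer_section: "is_minimizer (S, f) z \<Longrightarrow> is_minimizer (T, g) (s z)"
proof -
  show "optimal_value (S, f) = optimal_value (T, g)"
    unfolding optimal_value_def fst_conv snd_conv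
    by (intro antisym INF_mono) (use proj lift ereal_less_eq(3) in blast)+
  show "is_minimizer (S, f) (p v)" if "is_minimizer (T, g) v"
    using that unfolding is_minimizer_def is_arg_min_def fst_conv snd_conv
    by (meson proj lift not_less order_trans)
  show "is_minimizer (T, g) (s z)" if "is_minimizer (S, f) z"
    using that unfolding is_minimizer_def is_arg_min_def fst_conv snd_conv
    by (meson proj lift not_less order_trans)
qed

lemma vec_norm2_zero [simp]: "vec_norm2 (0\<^sub>v k) = 0"
  by (simp add: vec_norm2_def L2_set_def)

lemma append_cols_zero_mult_vec:
  assumes "A \<in> carrier_mat r k" "z \<in> carrier_vec k" "q \<in> carrier_vec k'"
  shows "append_cols A (0\<^sub>m r k') *\<^sub>v (z @\<^sub>v q) = A *\<^sub>v z"
proof (rule eq_vecI)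
  fix i assume "i < dim_vec (A *\<^sub>v z)"
  then have i: "i < r" using assms by simp
  \<comment> \<open>The lower blocks in \<open>append_cols\<close> have no rows, so each row is a
    row of \<open>A\<close> padded with zeros, and the padding annihilates \<open>q\<close> in the
    scalar product.\<close>
  have "row (append_cols A (0\<^sub>m r k')) i = row A i @\<^sub>v 0\<^sub>v k'"
    using assms i by (intro eq_vecI) (auto simp: append_cols_def)
  then show "(append_cols A (0\<^sub>m r k') *\<^sub>v (z @\<^sub>v q)) $ i = (A *\<^sub>v z) $ i"
    using assms i by (simp add: append_cols_def scalar_prod_append[of _ k _ k'])
qed (use assms in \<open>simp add: append_cols_def\<close>)

text \<open>Regroups the \<open>3 * N\<close> cone constraints so that the lower bound, the upper
  bound and the norm bound for one \<open>l\<close> can be treated together.\<close>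

lemma ball_atLeast1_triple:
  fixes N :: nat
  shows "(\<forall>i\<in>{1..3 * N}. P i) \<longleftrightarrow> (\<forall>l\<in>{1..N}. P l \<and> P (N + l) \<and> P (2 * N + l))"
proof
  assume R: "\<forall>l\<in>{1..N}. P l \<and> P (N + l) \<and> P (2 * N + l)"
  show "\<forall>i\<in>{1..3 * N}. P i"
  proof
    fix i assume i: "i \<in> {1..3 * N}"
    \<comment> \<open>Subtraction is truncated, so the equations say that nothing was cut off and
      put \<open>i\<close> in the form in which \<open>R\<close> applies.\<close>
    consider "i \<in> {1..N}" | "i - N \<in> {1..N}" "i = N + (i - N)"
      | "i - 2 * N \<in> {1..N}" "i = 2 * N + (i - 2 * N)"
      using i by fastforce
    then show "P i" using R by cases metis+
  qed
qed auto

text \<open>Bridges the 0-based components of vectors and the 1-based numbering of constraints and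
  of \<open>sigma\<close>.\<close>

lemma less_eq_vec_iff_atLeast1:
  fixes x y :: "real vec"
  assumes "x \<in> carrier_vec N" "y \<in> carrier_vec N"
  shows "x \<le> y \<longleftrightarrow> (\<forall>l\<in>{1..N}. x $ (l - 1) \<le> y $ (l - 1))"
proof -
  have "{..<N} = (\<lambda>l. l - 1) ` {1..N}" by (force simp: image_iff Bex_def intro: exI[of _ "Suc _"])
  then have "(\<forall>i<N. x $ i \<le> y $ i) \<longleftrightarrow> (\<forall>l\<in>{1..N}. x $ (l - 1) \<le> y $ (l - 1))"
    by (metis (no_types, lifting) imageE imageI lessThan_iff)
  then show ?thesis using assms by (simp add: less_eq_vec_def)
qed

lemma flat_le_iff:
  "flat N1 N2 K u \<le> flat N1 N2 K w \<longleftrightarrow> (\<forall>p\<in>grid N1 N2 K. u p \<le> w p)"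
proof -
  \<comment> \<open>Writing the index range as the image of \<open>sigma\<close> lets the quantifier
    pass to the grid, where \<open>flat_sigma\<close> evaluates the components.\<close>
  have "flat N1 N2 K u \<le> flat N1 N2 K w \<longleftrightarrow>
      (\<forall>l\<in>sigma N2 K ` grid N1 N2 K. flat N1 N2 K u $ (l - 1) \<le> flat N1 N2 K w $ (l - 1))"
    using less_eq_vec_iff_atLeast1[of _ "N1 * N2 * K"] bij_betw_imp_surj_on[OF bij_betw_sigma[of N2 K N1]]
    by simp
  then show ?thesis by (simp add: flat_sigma del: One_nat_def)
qed

lemma flat_mat_mult_flat:
  assumes "N1 \<ge> 2" "N2 \<ge> 2" "u \<in> arrays N1 N2 K" "p \<in> grid N1 N2 K"
  shows "flat_mat N1 N2 K h1 h2 t b (sigma N2 K p) *\<^sub>v flat N1 N2 K u =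
    ulog_op N1 N2 K h1 h2 t b u p"
proof -
  have M: "is_flat_mat N1 N2 K h1 h2 t b (sigma N2 K p) (flat_mat N1 N2 K h1 h2 t b (sigma N2 K p))"
    using is_flat_mat_flat_mat assms sigma_in by blast
  \<comment> \<open>\<open>is_flat_mat\<close> only fixes the components below 3, so equality of
    vectors also needs the length; it is known on the grid, where the restricted
    \<open>gradient\<close> is a list of three entries.\<close>
  have "dim_vec (ulog_op N1 N2 K h1 h2 t b u p) = 3"
    using assms(4) by (cases p) (simp add: ulog_op_def gradient_def)
  then show ?thesis
    using M assms(3,4) by (intro eq_vecI) (auto simp: is_flat_mat_def simp del: sigma.simps)
qed

text \<open>The bijection \<open>sigma\<close> reindexes the sum, and the summands then agree one by
  one.\<close>

lemma tv_objective_flat: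
  assumes "N1 \<ge> 2" "N2 \<ge> 2" "u \<in> arrays N1 N2 K"
  shows "(\<Sum>l\<in>{1..N1 * N2 * K}. vec_norm2 (flat_mat N1 N2 K h1 h2 t b l *\<^sub>v flat N1 N2 K u)) =
    (\<Sum>p\<in>grid N1 N2 K. vec_norm2 (ulog_op N1 N2 K h1 h2 t b u p))"
  by (subst sum.reindex_bij_betw[OF bij_betw_sigma, symmetric])
    (intro sum.cong refl; simp only: flat_mat_mult_flat[OF assms])

theorem proposition4:
  fixes N1 N2 K N n m :: nat and h1 h2 b :: real and t :: "nat \<Rightarrow> real"
    and ulow uupp :: array and A :: "nat \<Rightarrow> real mat" and zlow zupp \<xi> h :: "real vec"
    and B :: "nat \<Rightarrow> real mat" and c d :: "nat \<Rightarrow> real vec" and \<eta> :: "nat \<Rightarrow> real" and H :: "real mat"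
  assumes "N1 \<ge> 2" "N2 \<ge> 2" "K \<ge> 1" "h1 > 0" "h2 > 0" "b > 1"
    and "t 1 > 0" "\<forall>k\<in>{1..<K}. t k < t (k + 1)" "\<forall>k\<in>{1..<K}. t (k + 1) = b * t k"
    and "ulow \<in> arrays N1 N2 K" "uupp \<in> arrays N1 N2 K"
    and "\<forall>p\<in>grid N1 N2 K. ulow p \<le> uupp p"
    and "N = N1 * N2 * K"
    and "A = flat_mat N1 N2 K h1 h2 t b"
    and "zlow = flat N1 N2 K ulow" "zupp = flat N1 N2 K uupp"
    and "n = 2 * N" "m = 3 * N"
    and "\<xi> = 0\<^sub>v N @\<^sub>v vec N (\<lambda>_. 1)"
    and "H = 0\<^sub>m 1 n" "h = 0\<^sub>v 1"
    and "\<forall>l\<in>{1..N}. B l = 0\<^sub>m 1 n \<and> B (N + l) = 0\<^sub>m 1 n \<and>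
           B (2 * N + l) = append_cols (A l) (0\<^sub>m 3 N)"
    and "\<forall>l\<in>{1..N}. c l = 0\<^sub>v 1 \<and> c (N + l) = 0\<^sub>v 1 \<and> c (2 * N + l) = 0\<^sub>v 3"
    and "\<forall>l\<in>{1..N}. d l = unit_vec n (l - 1) \<and> d (N + l) = - unit_vec n (l - 1) \<and>
           d (2 * N + l) = unit_vec n (N + l - 1)"
    and "\<forall>l\<in>{1..N}. \<eta> l = - (zlow $ (l - 1)) \<and> \<eta> (N + l) = zupp $ (l - 1) \<and>
           \<eta> (2 * N + l) = 0"
  shows "equivalent_problems N (box_problem N A zlow zupp) (socp n m \<xi> B c d \<eta> H h) \<and>
    (\<forall>v\<in>carrier_vec (2 * N). is_minimizer (socp n m \<xi> B c d \<eta> H h) v \<longrightarrow>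
       is_minimizer (tv_ulog N1 N2 K h1 h2 t b ulow uupp) (unflat N1 N2 K v))"
proof -
  note N = \<open>N = N1 * N2 * K\<close>
  let ?box = "{z \<in> carrier_vec N. zlow \<le> z \<and> z \<le> zupp}"
  let ?F = "\<lambda>z. \<Sum>l\<in>{1..N}. vec_norm2 (A l *\<^sub>v z)"
  let ?tv = "{u \<in> arrays N1 N2 K. \<forall>p\<in>grid N1 N2 K. ulow p \<le> u p \<and> u p \<le> uupp p}"
  let ?G = "\<lambda>u. \<Sum>p\<in>grid N1 N2 K. vec_norm2 (ulog_op N1 N2 K h1 h2 t b u p)"
  define T where "T = fst (socp n m \<xi> B c d \<eta> H h)"
  \<comment> \<open>\<open>Suc l\<close> because components are numbered from 0 and the matrices
    from 1.\<close>
  let ?slack = "\<lambda>z. vec N (\<lambda>l. vec_norm2 (A (Suc l) *\<^sub>v z))"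
  have z_car: "zlow \<in> carrier_vec N" "zupp \<in> carrier_vec N" using assms by simp_all
  have A_car: "A l \<in> carrier_mat 3 N" if "l \<in> {1..N}" for l
    using is_flat_mat_flat_mat[of N1 N2 l K h1 h2 t b] that assms by (simp add: is_flat_mat_def)
  have cone: "z @\<^sub>v q \<in> T \<longleftrightarrow> z \<in> ?box \<and> (\<forall>l\<in>{1..N}. vec_norm2 (A l *\<^sub>v z) \<le> q $ (l - 1))"
    if z: "z \<in> carrier_vec N" and q: "q \<in> carrier_vec N" for z q
  proof -
    let ?v = "z @\<^sub>v q"
    have v: "?v \<in> carrier_vec n" using append_carrier_vec[OF z q] assms(17) by (simp add: mult_2)
    \<comment> \<open>Serves both the equality constraint, which becomes vacuous, and the left sides
      of the first two constraint families.\<close>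
    have zero: "0\<^sub>m 1 n *\<^sub>v ?v = 0\<^sub>v 1" using v by (intro eq_vecI) auto
    let ?C = "\<lambda>i. vec_norm2 (B i *\<^sub>v ?v + c i) \<le> d i \<bullet> ?v + \<eta> i"
    \<comment> \<open>In the first two families the norm is 0, which leaves linear bounds on one
      component of \<open>z\<close>. The third compares a norm with one component of
      \<open>q\<close>: an epigraph constraint.\<close>
    have C: "(?C l \<longleftrightarrow> zlow $ (l - 1) \<le> z $ (l - 1)) \<and>
        (?C (N + l) \<longleftrightarrow> z $ (l - 1) \<le> zupp $ (l - 1)) \<and>
        (?C (2 * N + l) \<longleftrightarrow> vec_norm2 (A l *\<^sub>v z) \<le> q $ (l - 1))" if l: "l \<in> {1..N}" for l
    proof -
      have i: "l - 1 < N" "l - 1 < n" "N + l - 1 < n" using l assms(17) by auto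
      have e: "?v $ (l - 1) = z $ (l - 1)" "?v $ (N + l - 1) = q $ (l - 1)"
        using z q i l by auto
      have u: "unit_vec n (l - 1) \<bullet> ?v = z $ (l - 1)" "unit_vec n (N + l - 1) \<bullet> ?v = q $ (l - 1)"
        using scalar_prod_left_unit[OF v i(2)] scalar_prod_left_unit[OF v i(3)] e by simp_all
      have nu: "- unit_vec n (l - 1) \<bullet> ?v = - z $ (l - 1)"
        using u carrier_vecD[OF v] by (subst scalar_prod_uminus_left) simp_all
      have "append_cols (A l) (0\<^sub>m 3 N) *\<^sub>v ?v + 0\<^sub>v 3 = A l *\<^sub>v z"
        using append_cols_zero_mult_vec[OF A_car[OF l] z q] A_car[OF l] z by simp
      then show ?thesis
        using assms(22-25) l zero u nu by (auto simp del: One_nat_def)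
    qed
    have "?v \<in> T \<longleftrightarrow> (\<forall>l\<in>{1..N}. ?C l \<and> ?C (N + l) \<and> ?C (2 * N + l))"
      using v zero assms(18,20,21) by (simp add: T_def socp_def ball_atLeast1_triple del: One_nat_def)
    then show ?thesis
      using C z z_car by (auto simp: less_eq_vec_iff_atLeast1[of _ N] simp del: One_nat_def)
  qed
  \<comment> \<open>The zero half of \<open>\<xi>\<close> hides \<open>z\<close>, so the cone
    objective sees only the slack.\<close>
  have cost: "\<xi> \<bullet> (z @\<^sub>v q) = (\<Sum>l<N. q $ l)"
    if "z \<in> carrier_vec N" "q \<in> carrier_vec N" for z q
    using that unfolding assms(19)
    by (subst scalar_prod_append[of _ N _ N]) (auto simp: scalar_prod_def atLeast0LessThan)
  \<comment> \<open>Makes \<open>cone\<close> and \<open>cost\<close>, stated for concatenations,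
    applicable to an arbitrary feasible point.\<close>
  have split: "vec_first v N @\<^sub>v vec_last v N = v" if "v \<in> T" for v
    using that assms(17) by (simp add: T_def socp_def mult_2)
  have proj: "vec_first v N \<in> ?box \<and> ?F (vec_first v N) \<le> \<xi> \<bullet> v" if "v \<in> T" for v
  proof -
    let ?z = "vec_first v N" and ?q = "vec_last v N"
    have "?z @\<^sub>v ?q \<in> T" using that split[OF that] by simp
    then have c: "?z \<in> ?box" "\<forall>l\<in>{1..N}. vec_norm2 (A l *\<^sub>v ?z) \<le> ?q $ (l - 1)"
      using cone by auto
    have "?F ?z \<le> (\<Sum>l\<in>{1..N}. ?q $ (l - 1))" using c(2) by (intro sum_mono) auto
    also have "\<dots> = \<xi> \<bullet> (?z @\<^sub>v ?q)" by (simp add: sum.atLeast1_atMost_eq cost)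
    finally show ?thesis using c(1) split[OF that] by simp
  qed
  \<comment> \<open>With the norms as slack, every epigraph constraint holds with equality, and the
    slack sums to the box objective.\<close>
  have lift: "z @\<^sub>v ?slack z \<in> T \<and> \<xi> \<bullet> (z @\<^sub>v ?slack z) \<le> ?F z" if "z \<in> ?box" for z
  proof
    have z: "z \<in> carrier_vec N" using that by simp
    show "z @\<^sub>v ?slack z \<in> T" using that cone[OF z, of "?slack z"] by auto
    show "\<xi> \<bullet> (z @\<^sub>v ?slack z) \<le> ?F z"
      using cost[OF z, of "?slack z"] by (simp add: sum.atLeast1_atMost_eq)
  qed
  have box: "box_problem N A zlow zupp = (?box, ?F)"
    and socp: "socp n m \<xi> B c d \<eta> H h = (T, \<lambda>v. \<xi> \<bullet> v)"
    and tv: "tv_ulog N1 N2 K h1 h2 t b ulow uupp = (?tv, ?G)"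
    by (simp_all add: T_def box_problem_def socp_def tv_ulog_def)
  have F_flat: "?F (flat N1 N2 K u) = ?G u" if "u \<in> arrays N1 N2 K" for u
    using tv_objective_flat[OF assms(1,2) that] assms(13,14) by simp
  have flat_box: "flat N1 N2 K u \<in> ?box \<longleftrightarrow> u \<in> ?tv" if "u \<in> arrays N1 N2 K" for u
    using that assms(13,15,16) by (auto simp: flat_le_iff)
  \<comment> \<open>Since \<open>z\<close> is the flattening of \<open>unflat N1 N2 K z\<close>,
    feasibility and objective carry over from the two preceding facts.\<close>
  have unflat_proj: "unflat N1 N2 K z \<in> ?tv \<and> ?G (unflat N1 N2 K z) \<le> ?F z" if "z \<in> ?box" for z
    using that F_flat[OF unflat_in_arrays, of z] flat_box[OF unflat_in_arrays, of z]
    by (simp add: flat_unflat N)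
  have flat_lift: "flat N1 N2 K u \<in> ?box \<and> ?F (flat N1 N2 K u) \<le> ?G u" if "u \<in> ?tv" for u
  proof -
    have "u \<in> arrays N1 N2 K" using that by simp
    then show ?thesis using that F_flat[of u] flat_box[of u] by simp
  qed
  have same_value: "optimal_value (?box, ?F) = optimal_value (T, \<lambda>v. \<xi> \<bullet> v)"
    by (rule optimal_value_eq_of_section[where p = "\<lambda>v. vec_first v N"
          and s = "\<lambda>z. z @\<^sub>v ?slack z"]) (erule proj, erule lift)
  have min_proj: "is_minimizer (?box, ?F) (vec_first v N)"
    if "is_minimizer (T, \<lambda>v. \<xi> \<bullet> v) v" for v
    by (rule is_minimizer_proj[where p = "\<lambda>v. vec_first v N"
          and s = "\<lambda>z. z @\<^sub>v ?slack z", OF _ _ that]) (erule proj, erule lift)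
  have min_lift: "is_minimizer (T, \<lambda>v. \<xi> \<bullet> v) (z @\<^sub>v ?slack z)"
    if "is_minimizer (?box, ?F) z" for z
    by (rule is_minimizer_section[where p = "\<lambda>v. vec_first v N"
          and s = "\<lambda>z. z @\<^sub>v ?slack z", OF _ _ that]) (erule proj, erule lift)
  \<comment> \<open>The box problem now takes the part of \<open>(T, g)\<close> in the transfer
    lemma, with \<open>unflat\<close> as projection.\<close>
  have min_unflat: "is_minimizer (?tv, ?G) (unflat N1 N2 K z)" if "is_minimizer (?box, ?F) z" for z
    by (rule is_minimizer_proj[where p = "unflat N1 N2 K" and s = "flat N1 N2 K", OF _ _ that])
      (erule unflat_proj, erule flat_lift)
  \<comment> \<open>Forwards the witness is the vector of norms. Backwards any \<open>q\<close> will
    do, because projecting \<open>z @\<^sub>v q\<close> returns \<open>z\<close>.\<close>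
  have iff: "is_minimizer (?box, ?F) z \<longleftrightarrow>
      (\<exists>q\<in>carrier_vec N. is_minimizer (T, \<lambda>v. \<xi> \<bullet> v) (z @\<^sub>v q))"
    if z: "z \<in> carrier_vec N" for z
  proof
    assume "is_minimizer (?box, ?F) z"
    then show "\<exists>q\<in>carrier_vec N. is_minimizer (T, \<lambda>v. \<xi> \<bullet> v) (z @\<^sub>v q)"
      by (intro bexI[of _ "?slack z"] min_lift vec_carrier)
  next
    assume "\<exists>q\<in>carrier_vec N. is_minimizer (T, \<lambda>v. \<xi> \<bullet> v) (z @\<^sub>v q)"
    then obtain q where "is_minimizer (T, \<lambda>v. \<xi> \<bullet> v) (z @\<^sub>v q)" by blast
    moreover have "vec_first (z @\<^sub>v q) N = z"
      using z by (intro eq_vecI) (auto simp: vec_first_def)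
    ultimately show "is_minimizer (?box, ?F) z" using min_proj[of "z @\<^sub>v q"] by simp
  qed
  have tv_min: "is_minimizer (?tv, ?G) (unflat N1 N2 K v)"
    if "is_minimizer (T, \<lambda>v. \<xi> \<bullet> v) v" for v
  proof -
    \<comment> \<open>On the grid \<open>sigma\<close> is at most \<open>N\<close>, so
      \<open>unflat\<close> reads only the first half of \<open>v\<close> and never the slack; off
      the grid both sides are \<open>undefined\<close>.\<close>
    have "unflat N1 N2 K (vec_first v N) = unflat N1 N2 K v"
    proof (rule ext)
      fix p
      have "vec_first v N $ (sigma N2 K p - 1) = v $ (sigma N2 K p - 1)" if "p \<in> grid N1 N2 K"
        using sigma_in[OF that] N by (auto simp: vec_first_def simp del: sigma.simps)
      then show "unflat N1 N2 K (vec_first v N) p = unflat N1 N2 K v p"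
        by (simp add: unflat_def del: sigma.simps)
    qed
    then show ?thesis using min_unflat[OF min_proj[OF that]] by (simp only:)
  qed
  show ?thesis
    unfolding equivalent_problems_def box socp tv
    by (intro conjI ballI impI same_value iff tv_min)
qed

end
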